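(* For a nonnegative integer $n$, let $b_3(n)$ denote the number of $3$-regular partitions of $n$. Let $\alpha\in\{6,64,93,122,151,180,209,238,267,296,325,354,383,412,441,470,499,528,557,586,615,644,673,702,731,760,789,818\}$. Then for all integers $n\geq 0$, $$b_3(2(29^2\cdot n+\alpha))\equiv 0\pmod 2.$$
   Context: For a positive integer $\ell$, an $\ell$-regular partition of $n$ is a partition of $n$ none of whose parts is divisible by $\ell$; $b_\ell(n)$ denotes the number of $\ell$-regular partitions of $n$, with $b_\ell(0)=1$. Equivalently, $\sum_{n=0}^{\infty}b_{\ell}(n)q^n=\prod_{j=1}^{\infty}\frac{1-q^{\ell j}}{1-q^{j}}$. *)

theory Defs
  imports "HOL-Library.Multiset" "HOL-Number_Theory.Cong"
begin

text \<open>A partition of \<open>n\<close> is a finite multiset of positive integers with sum \<open>n\<close>.\<close>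

definition partitions :: "nat \<Rightarrow> nat multiset set" where
  "partitions n = {P. (\<forall>p \<in># P. 0 < p) \<and> sum_mset P = n}"

definition regular_partitions :: "nat \<Rightarrow> nat \<Rightarrow> nat multiset set" where
  "regular_partitions l n = {P \<in> partitions n. \<forall>p \<in># P. \<not> l dvd p}"

definition num_regular_partitions :: "nat \<Rightarrow> nat \<Rightarrow> nat" where
  "num_regular_partitions l n = card (regular_partitions l n)"

text \<open>Finiteness ensures that \<open>card\<close> above is a genuine count.\<close>

lemma size_le_sum_mset:
  fixes P :: "nat multiset"
  assumes "\<forall>p \<in># P. 0 < p"
  shows "size P \<le> sum_mset P"
  using assms by (induction P) auto

lemma finite_partitions: "finite (partitions n)"
proof (rule finite_subset)
  show "partitions n \<subseteq> mset ` {xs. set xs \<subseteq> {..n} \<and> length xs \<le> n}"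
  proof
    fix P assume "P \<in> partitions n"
    then have P: "\<forall>p \<in># P. 0 < p" "sum_mset P = n"
      by (auto simp: partitions_def)
    obtain xs where xs: "mset xs = P"
      using ex_mset by blast
    have "length xs \<le> n"
      using size_le_sum_mset[OF P(1)] P(2) xs by auto
    moreover have "set xs \<subseteq> {..n}"
      using P(2) xs member_le_sum_list[of _ xs] by (auto simp: sum_mset_sum_list)
    ultimately show "P \<in> mset ` {xs. set xs \<subseteq> {..n} \<and> length xs \<le> n}"
      using xs by blast
  qed
  show "finite (mset ` {xs. set xs \<subseteq> {..n} \<and> length xs \<le> n})"
    by (intro finite_imageI finite_lists_length_le) simp
qed

lemma finite_regular_partitions: "finite (regular_partitions l n)"
  unfolding regular_partitions_def using finite_partitions by simp

lemma num_regular_partitions_0: "num_regular_partitions l 0 = 1"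
proof -
  have "P = {#}" if "P \<in> partitions 0" for P
    using size_le_sum_mset[of P] that by (simp add: partitions_def del: sum_mset_0_iff)
  moreover have "{#} \<in> regular_partitions l 0"
    by (simp add: regular_partitions_def partitions_def)
  ultimately have "regular_partitions l 0 = {{#}}"
    unfolding regular_partitions_def by blast
  then show ?thesis
    by (simp add: num_regular_partitions_def)
qed

end

theory Submission
  imports Defs "HOL-Library.FuncSet" "HOL-Library.Z2" "HOL-Computational_Algebra.Formal_Laurent_Series"
begin

text \<open>
  Work with power series over the field with two elements and put
  \<open>\<theta> = \<Prod>\<^sub>j (1 - X\<^sup>j)\<close>, which by the pentagonal number theorem is the sum of
  \<open>X ^ ((u\<^sup>2 - 1) / 24)\<close> over the positive \<open>u\<close> prime to 6. From \<open>F \<theta> = \<theta>(X\<^sup>3)\<close> for the series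
  \<open>F\<close> of \<open>b\<^sub>3\<close> and \<open>\<theta>\<^sup>2 = \<theta>(X\<^sup>2)\<close> one gets \<open>F \<theta>(X\<^sup>2) = \<theta> \<theta>(X\<^sup>3)\<close>. Comparing even
  coefficients, and relating the solutions of \<open>u\<^sup>2 + 3 w\<^sup>2 = 48 n + 4\<close> to those of
  \<open>p\<^sup>2 + 12 m\<^sup>2 = 12 n + 1\<close>, yields that \<open>b\<^sub>3(2 n)\<close> has the parity of the number of solutions of
  \<open>u\<^sup>2 + 24 m\<^sup>2 = 24 n + 1\<close> with \<open>u > 0\<close> and either \<open>m = 0\<close> or \<open>m > 0\<close> not divisible by 3. If 29
  divides \<open>24 n + 1\<close> exactly once, division by a prime above 29 in \<open>\<int>[\<surd>-6]\<close> turns these into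
  solutions of \<open>2 x\<^sup>2 + 3 y\<^sup>2 = (24 n + 1) / 29\<close>, which the sign change of \<open>y\<close> pairs off.
\<close>

section \<open>Binary quadratic forms\<close>

text \<open>For \<open>u = 6 k + 1\<close> and \<open>u = 6 k - 1\<close> the value
  \<open>(u\<^sup>2 - 1) / 24\<close> is \<open>k (3 k + 1) / 2\<close> and
  \<open>k (3 k - 1) / 2\<close>, so positive \<open>u\<close> prime to 6 index the generalized
  pentagonal numbers, each exactly once.\<close>

definition coprime6 :: "int set" where
  "coprime6 = {u. 0 < u \<and> odd u \<and> \<not> 3 dvd u}"

text \<open>The sign change of the second coordinate is an involution of \<open>A\<close> without
  fixed points.\<close>

lemma even_card_negate_snd:
  fixes A :: "('a \<times> int) set"
  assumes "finite A" and neg: "\<And>x y. (x, y) \<in> A \<Longrightarrow> y \<noteq> 0 \<and> (x, - y) \<in> A"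
  shows "even (card A)"
proof -
  let ?P = "{z \<in> A. snd z > 0}" and ?N = "{z \<in> A. snd z < 0}"
  have "bij_betw (\<lambda>z. (fst z, - snd z)) ?P ?N"
    by (rule bij_betwI[where g = "\<lambda>z. (fst z, - snd z)"]) (auto dest: neg)
  then have eq: "card ?P = card ?N"
    by (rule bij_betw_same_card)
  have "A = ?P \<union> ?N"
    using neg by (force simp: neq_iff)
  then have "card A = card (?P \<union> ?N)" by simp
  also have "\<dots> = card ?P + card ?N"
    using assms(1) by (intro card_Un_disjoint) auto
  finally show ?thesis using eq by simp
qed

lemma finite_square_form:
  fixes a b N :: int
  assumes "a > 0" "b > 0"
  shows "finite {(x, y). a * x\<^sup>2 + b * y\<^sup>2 = N}"
proof (rule finite_subset)
  show "{(x, y). a * x\<^sup>2 + b * y\<^sup>2 = N} \<subseteq> {-N..N} \<times> {-N..N}"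
  proof (rule subrelI)
    fix x y assume "(x, y) \<in> {(x, y). a * x\<^sup>2 + b * y\<^sup>2 = N}"
    then have N: "a * x\<^sup>2 + b * y\<^sup>2 = N" by simp
    have sq: "\<bar>z\<bar> \<le> z\<^sup>2" for z :: int
      using self_le_power[of "\<bar>z\<bar>" 2] by (cases "z = 0") auto
    have "x\<^sup>2 \<le> a * x\<^sup>2" "y\<^sup>2 \<le> b * y\<^sup>2"
      using assms by (auto simp: mult_le_cancel_right1)
    moreover have "0 \<le> x\<^sup>2" "0 \<le> y\<^sup>2" by auto
    ultimately have "\<bar>x\<bar> \<le> N" "\<bar>y\<bar> \<le> N"
      using sq[of x] sq[of y] N by linarith+
    then show "(x, y) \<in> {-N..N} \<times> {-N..N}" by auto
  qed
qed simp

text \<open>Every unit modulo 24 is its own inverse.\<close>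

lemma square_coprime6:
  assumes "odd u" "\<not> 3 dvd (u :: int)"
  shows "u\<^sup>2 mod 24 = 1"
proof -
  have "u mod 24 = 1 \<or> u mod 24 = 5 \<or> u mod 24 = 7 \<or> u mod 24 = 11 \<or>
    u mod 24 = 13 \<or> u mod 24 = 17 \<or> u mod 24 = 19 \<or> u mod 24 = 23"
    using assms by presburger
  then have "(u mod 24)\<^sup>2 mod 24 = 1" by auto
  then show ?thesis by (simp add: power_mod)
qed

lemma square_mod_3: "(x :: int)\<^sup>2 mod 3 = (if 3 dvd x then 0 else 1)"
proof -
  have "x mod 3 = 0 \<or> x mod 3 = 1 \<or> x mod 3 = 2" by presburger
  then have "(x mod 3)\<^sup>2 mod 3 = (if x mod 3 = 0 then 0 else 1)" by auto
  then show ?thesis by (simp add: power_mod dvd_eq_mod_eq_0)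
qed

lemma square_mod_8: "odd (x :: int) \<Longrightarrow> x\<^sup>2 mod 8 = 1"
proof -
  assume "odd x"
  then have "x mod 8 = 1 \<or> x mod 8 = 3 \<or> x mod 8 = 5 \<or> x mod 8 = 7" by presburger
  then have "(x mod 8)\<^sup>2 mod 8 = 1" by auto
  then show ?thesis by (simp add: power_mod)
qed

text \<open>
  The prime \<open>29 = 2 + 3 \<cdot> 3\<^sup>2\<close> is the norm of \<open>\<pi> = \<surd>2 + 3 \<surd>-3\<close>, and
  \<open>\<pi> (x \<surd>2 + y \<surd>-3) = (2 x - 9 y) + (3 x + y) \<surd>-6\<close>.
\<close>

lemma even_card_reps_29:
  fixes M n :: int
  assumes M: "29 * M = 24 * n + 1" and "\<not> 29 dvd M"
  shows "even (card {(u, m). u \<in> coprime6 \<and> 0 \<le> m \<and> (m = 0 \<or> \<not> 3 dvd m) \<and>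
    u\<^sup>2 + 24 * m\<^sup>2 = 24 * n + 1})" (is "even (card ?A)")
proof -
  \<comment> \<open>The condition \<open>0 < x\<close> picks one of \<open>(x, y)\<close> and
    \<open>(- x, - y)\<close>, whose images differ only in sign.\<close>
  define B where "B = {(x, y). 0 < x \<and> \<not> 3 dvd y \<and> 2 * x\<^sup>2 + 3 * y\<^sup>2 = M}"
  have norm: "(2 * x - 9 * y)\<^sup>2 + 6 * (3 * x + y)\<^sup>2 = 29 * (2 * x\<^sup>2 + 3 * y\<^sup>2)" for x y :: int
    by (simp add: power2_eq_square algebra_simps)
  \<comment> \<open>The inverse of 29 modulo 24 is 5, since
    \<open>29 * 5 = 1 + 6 * 24\<close>.\<close>
  have "M = 5 + 24 * (5 * n - 6 * M)" using M by simp
  then have M24: "M mod 24 = 5" by (metis mod_mult_self2 mod_pos_pos_trivial zero_le_numeral numeral_less_iff semiring_norm(75,76,77,78,79,80,81))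
  \<comment> \<open>As \<open>M\<close> is odd, so is \<open>y\<close>; then
    \<open>2 * x\<^sup>2\<close> is 2 modulo 8, and it is also 2 modulo 3.\<close>
  have B: "odd x \<and> odd y \<and> \<not> 3 dvd x" if "2 * x\<^sup>2 + 3 * y\<^sup>2 = M" for x y
  proof -
    have *: "odd b" "a mod 3 \<noteq> 0" "b mod 8 = 1 \<Longrightarrow> odd a" if "2 * a + 3 * b = M" for a b
      using M24 that by presburger+
    have y: "odd y" using *(1)[OF that] by simp
    have x: "odd x" using *(3)[OF that square_mod_8[OF y]] by simp
    have "x\<^sup>2 mod 3 \<noteq> 0" using *(2)[OF that] .
    with x y show ?thesis using square_mod_3[of x] by auto
  qed
  \<comment> \<open>The square roots of -6 modulo 29 are 9 and -9, so the two divisibilities say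
    that both primes above 29 divide \<open>u + v \<surd>-6\<close>. Then 29 would divide
    \<open>M\<close>.\<close>
  have not_both: False
    if "29 dvd u + 9 * v" "29 dvd u - 9 * v" "u\<^sup>2 + 6 * v\<^sup>2 = 29 * M" for u v :: int
  proof -
    have "29 dvd u" "29 dvd v" using that(1,2) by presburger+
    then obtain a b where "u = 29 * a" "v = 29 * b" by (auto elim!: dvdE)
    then have "29 * (29 * (a\<^sup>2 + 6 * b\<^sup>2)) = 29 * M"
      using that(3) by (simp add: power2_eq_square algebra_simps)
    then have "M = 29 * (a\<^sup>2 + 6 * b\<^sup>2)" by simp
    with assms(2) show False by simp
  qed
  have "bij_betw (\<lambda>(x, y). (\<bar>2 * x - 9 * y\<bar>, \<bar>3 * x + y\<bar> div 2)) B ?A"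
    unfolding bij_betw_def
  proof
    show "inj_on (\<lambda>(x, y). (\<bar>2 * x - 9 * y\<bar>, \<bar>3 * x + y\<bar> div 2)) B"
    proof (rule inj_onI, clarify)
      fix x y x' y'
      assume B1: "(x, y) \<in> B" and B2: "(x', y') \<in> B"
        and u: "\<bar>2 * x - 9 * y\<bar> = \<bar>2 * x' - 9 * y'\<bar>"
        and v: "\<bar>3 * x + y\<bar> div 2 = \<bar>3 * x' + y'\<bar> div 2"
      have x: "0 < x" "2 * x\<^sup>2 + 3 * y\<^sup>2 = M" "0 < x'" "2 * x'\<^sup>2 + 3 * y'\<^sup>2 = M"
        using B1 B2 by (auto simp: B_def)
      note odd = B[OF x(2)] B[OF x(4)]
      have "even \<bar>3 * x + y\<bar>" "even \<bar>3 * x' + y'\<bar>" using odd by simp_all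
      then have v: "\<bar>3 * x + y\<bar> = \<bar>3 * x' + y'\<bar>"
        using v by (metis dvd_div_mult_self)
      have *: "(2 * x - 9 * y) + 9 * (3 * x + y) = 29 * x"
        "(2 * x' - 9 * y') + 9 * (3 * x' + y') = 29 * x'" by simp_all
      have n: "(2 * x - 9 * y)\<^sup>2 + 6 * (3 * x + y)\<^sup>2 = 29 * M"
        using norm[of x y] x(2) by simp
      have False if "29 dvd (2 * x - 9 * y) - 9 * (3 * x + y)"
        using not_both[OF _ that n] * by simp
      \<comment> \<open>With opposite relative signs, this difference is plus or minus the sum that
        equals \<open>29 * x'\<close>, so both primes above 29 would divide. Two minus signs would
        give \<open>x = - x'\<close>, against positivity.\<close>
      moreover have "29 dvd (2 * x - 9 * y) - 9 * (3 * x + y)"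
        if "2 * x - 9 * y = 2 * x' - 9 * y' \<and> 3 * x + y = - (3 * x' + y') \<or>
          2 * x - 9 * y = - (2 * x' - 9 * y') \<and> 3 * x + y = 3 * x' + y'"
      proof -
        have "(2 * x - 9 * y) - 9 * (3 * x + y) = 29 * x' \<or>
          (2 * x - 9 * y) - 9 * (3 * x + y) = 29 * (- x')" using that by auto
        then show ?thesis by (metis dvd_triv_left)
      qed
      ultimately show "x = x' \<and> y = y'"
        using u v x by (auto simp: abs_eq_iff)
    qed
    show "(\<lambda>(x, y). (\<bar>2 * x - 9 * y\<bar>, \<bar>3 * x + y\<bar> div 2)) ` B = ?A"
    proof (intro equalityI subsetI; clarify)
      fix x y assume "(x, y) \<in> B"
      then have x: "2 * x\<^sup>2 + 3 * y\<^sup>2 = M" "\<not> 3 dvd y" by (auto simp: B_def)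
      note odd = B[OF x(1)]
      define m where "m = \<bar>3 * x + y\<bar> div 2"
      have m: "\<bar>3 * x + y\<bar> = 2 * m" using odd by (simp add: m_def)
      have "(3 * x + y)\<^sup>2 = 4 * m\<^sup>2" using arg_cong[OF m, of "\<lambda>z. z\<^sup>2"] by (simp add: power_mult_distrib)
      then have "(2 * x - 9 * y)\<^sup>2 + 24 * m\<^sup>2 = 24 * n + 1"
        using norm[of x y] x M by simp
      moreover have "\<not> 3 dvd m" using m x(2) by presburger
      moreover have "odd (2 * x - 9 * y)" "\<not> 3 dvd (2 * x - 9 * y)"
        using odd by (simp, presburger)
      moreover from this have "2 * x - 9 * y \<noteq> 0" by auto
      ultimately show "\<bar>2 * x - 9 * y\<bar> \<in> coprime6 \<and> 0 \<le> m \<and> (m = 0 \<or> \<not> 3 dvd m) \<and>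
          \<bar>2 * x - 9 * y\<bar>\<^sup>2 + 24 * m\<^sup>2 = 24 * n + 1"
        unfolding coprime6_def by (simp add: m_def)
    next
      fix u m
      assume u: "u \<in> coprime6" and m: "0 \<le> m" "m = 0 \<or> \<not> 3 dvd m"
        and e: "u\<^sup>2 + 24 * m\<^sup>2 = 24 * n + 1"
      \<comment> \<open>Because \<open>81 + 6 = 3 * 29\<close>, the norm
        \<open>u\<^sup>2 + 6 v\<^sup>2\<close> with \<open>v = 2 m\<close> factors modulo 29 as
        \<open>(u + 9 v) (u - 9 v)\<close>. The sign of \<open>v\<close> is then chosen so that 29
        divides the first factor.\<close>
      have "(u + 9 * (2 * m)) * (u - 9 * (2 * m)) = 29 * (M - 12 * m\<^sup>2)"
        using e M by (simp add: power2_eq_square algebra_simps)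
      then have "29 dvd (u + 9 * (2 * m)) * (u - 9 * (2 * m))" by simp
      then have "29 dvd u + 9 * (2 * m) \<or> 29 dvd u - 9 * (2 * m)"
        by (subst (asm) prime_dvd_mult_iff) simp_all
      then obtain v where v: "\<bar>v\<bar> = 2 * m" "29 dvd u + 9 * v"
        using m(1) by (metis abs_of_nonneg abs_minus_cancel diff_conv_add_uminus mult_minus_right
            mult_nonneg_nonneg zero_le_numeral)
      then obtain x where x: "u + 9 * v = 29 * x" by (auto elim: dvdE)
      \<comment> \<open>The pair \<open>x = (u + 9 v) / 29\<close>, \<open>y = v - 3 x\<close> is
        the quotient by the prime above 29.\<close>
      define y where "y = v - 3 * x"
      have uv: "u = 2 * x - 9 * y" "v = 3 * x + y" using x by (auto simp: y_def)
      have "v\<^sup>2 = 4 * m\<^sup>2" using arg_cong[OF v(1), of "\<lambda>z. z\<^sup>2"] by (simp add: power_mult_distrib)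
      then have xy: "2 * x\<^sup>2 + 3 * y\<^sup>2 = M"
        using norm[of x y] e M unfolding uv(1)[symmetric] uv(2)[symmetric] by simp
      \<comment> \<open>For \<open>m = 0\<close> the square \<open>u\<^sup>2\<close> would be
        divisible by 29 exactly once.\<close>
      have "m \<noteq> 0"
      proof
        assume "m = 0"
        then have "v = 0" using v by simp
        then show False using not_both[of u v] v(2) e M \<open>m = 0\<close> by simp
      qed
      then have "\<not> 3 dvd m" using m by simp
      then have y3: "\<not> 3 dvd y" using v(1) uv(2) by presburger
      \<comment> \<open>Multiplying by the sign makes the first coordinate positive and leaves the
        absolute values unchanged.\<close>
      define s where "s = sgn x"
      have "x \<noteq> 0" using B[OF xy] by auto
      then have "0 < s * x" and s: "s = 1 \<or> s = -1" by (auto simp: s_def sgn_if)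
      moreover have "\<not> 3 dvd s * y" "2 * (s * x)\<^sup>2 + 3 * (s * y)\<^sup>2 = M"
        using s xy y3 by auto
      ultimately have "(s * x, s * y) \<in> B" by (simp add: B_def)
      moreover have "\<bar>2 * (s * x) - 9 * (s * y)\<bar> = u" "\<bar>3 * (s * x) + s * y\<bar> div 2 = m"
        using s uv v u by (auto simp: coprime6_def)
      ultimately show "(u, m) \<in> (\<lambda>(x, y). (\<bar>2 * x - 9 * y\<bar>, \<bar>3 * x + y\<bar> div 2)) ` B"
        by force
    qed
  qed
  from bij_betw_same_card[OF this] have "card ?A = card B" ..
  moreover have "finite B"
    by (rule finite_subset[OF _ finite_square_form[of 2 3 M]]) (auto simp: B_def)
  then have "even (card B)"
    by (rule even_card_negate_snd) (auto simp: B_def)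
  ultimately show ?thesis by simp
qed

text \<open>
  Both sides count the integers \<open>(p, m)\<close> with \<open>p\<^sup>2 + 12 m\<^sup>2 = 12 n + 1\<close>, \<open>p > 0\<close>, \<open>p - 2 m\<close> prime to 3:
  on the left via \<open>(u, w) = (\<bar>p + 6 m\<bar>, \<bar>p - 2 m\<bar>)\<close>, on the right up to the involution
  \<open>m \<mapsto> -m\<close> on the solutions with \<open>m \<noteq> 0\<close> and \<open>3 dvd m\<close>.
\<close>

lemma parity_card_reps:
  fixes n :: int
  shows "even (card {(u, w). u \<in> coprime6 \<and> w \<in> coprime6 \<and> u\<^sup>2 + 3 * w\<^sup>2 = 48 * n + 4}) \<longleftrightarrow>
    even (card {(p, m). p \<in> coprime6 \<and> 0 \<le> m \<and> (m = 0 \<or> \<not> 3 dvd m) \<and> p\<^sup>2 + 12 * m\<^sup>2 = 12 * n + 1})"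
    (is "even (card ?W) \<longleftrightarrow> even (card ?V)")
proof -
  define Z where "Z = {(p, m). p \<in> coprime6 \<and> \<not> 3 dvd p - 2 * m \<and> p\<^sup>2 + 12 * m\<^sup>2 = 12 * n + 1}"
  have "finite Z"
    by (rule finite_subset[OF _ finite_square_form[of 1 12 "12 * n + 1"]]) (auto simp: Z_def)
  have "bij_betw (\<lambda>(p, m). (\<bar>p + 6 * m\<bar>, \<bar>p - 2 * m\<bar>)) Z ?W"
    unfolding bij_betw_def
  proof
    show "inj_on (\<lambda>(p, m). (\<bar>p + 6 * m\<bar>, \<bar>p - 2 * m\<bar>)) Z"
    proof (rule inj_onI, clarify)
      fix p m p' m'
      assume "(p, m) \<in> Z" "(p', m') \<in> Z" 
        and *: "\<bar>p + 6 * m\<bar> = \<bar>p' + 6 * m'\<bar>" "\<bar>p - 2 * m\<bar> = \<bar>p' - 2 * m'\<bar>"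
      then have p: "0 < p" "0 < p'" "odd p" by (auto simp: Z_def coprime6_def)
      \<comment> \<open>Two minus signs contradict positivity; in the mixed cases, adding the
        equations shows that \<open>p\<close> is even.\<close>
      consider "p + 6 * m = p' + 6 * m'" "p - 2 * m = p' - 2 * m'"
        | "p + 6 * m = - (p' + 6 * m')" "p - 2 * m = - (p' - 2 * m')"
        | "p + 6 * m = p' + 6 * m'" "p - 2 * m = - (p' - 2 * m')"
        | "p + 6 * m = - (p' + 6 * m')" "p - 2 * m = p' - 2 * m'"
        using * unfolding abs_eq_iff by blast
      then show "p = p' \<and> m = m'"
      proof cases
        case 3
        then have "p = 2 * (2 * m' - m)" by simp
        with p show ?thesis by simp
      next
        case 4
        then have "p = 2 * (- 2 * m' - m)" by simp
        with p show ?thesis by simp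
      qed (use p in auto)
    qed
    show "(\<lambda>(p, m). (\<bar>p + 6 * m\<bar>, \<bar>p - 2 * m\<bar>)) ` Z = ?W"
    proof (intro equalityI subsetI; clarify)
      fix p m assume "(p, m) \<in> Z"
      then have p: "odd p" "\<not> 3 dvd p" "\<not> 3 dvd p - 2 * m" "p\<^sup>2 + 12 * m\<^sup>2 = 12 * n + 1"
        by (auto simp: Z_def coprime6_def)
      have "(p + 6 * m)\<^sup>2 + 3 * (p - 2 * m)\<^sup>2 = 4 * (p\<^sup>2 + 12 * m\<^sup>2)"
        by (simp add: power2_eq_square algebra_simps)
      moreover have "odd (p + 6 * m)" "odd (p - 2 * m)" using p by simp_all
      moreover have "\<not> 3 dvd p + 6 * m" using p by presburger
      moreover have "p + 6 * m \<noteq> 0" "p - 2 * m \<noteq> 0" using p by presburger+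
      ultimately show "\<bar>p + 6 * m\<bar> \<in> coprime6 \<and> \<bar>p - 2 * m\<bar> \<in> coprime6 \<and>
        \<bar>p + 6 * m\<bar>\<^sup>2 + 3 * \<bar>p - 2 * m\<bar>\<^sup>2 = 48 * n + 4"
        using p by (simp add: coprime6_def)
    next
      fix u w
      assume uw: "u \<in> coprime6" "w \<in> coprime6" and e: "u\<^sup>2 + 3 * w\<^sup>2 = 48 * n + 4"
      \<comment> \<open>The square of an odd number modulo 16 determines the number modulo 8 up to
        sign.\<close>
      have sq: "x\<^sup>2 mod 16 = (if x mod 8 = 1 \<or> x mod 8 = 7 then 1 else 9)" if "odd x" for x :: int
      proof -
        have "(x mod 16)\<^sup>2 mod 16 = (if x mod 16 mod 8 = 1 \<or> x mod 16 mod 8 = 7 then 1 else 9)"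
        proof -
          have "x mod 16 = 1 \<or> x mod 16 = 3 \<or> x mod 16 = 5 \<or> x mod 16 = 7 \<or> x mod 16 = 9 \<or>
            x mod 16 = 11 \<or> x mod 16 = 13 \<or> x mod 16 = 15" using that by presburger
          then show ?thesis by auto
        qed
        then show ?thesis by (simp add: power_mod mod_mod_cancel)
      qed
      have odd: "odd u" "odd w" and pos: "0 < u" "0 < w" and w3: "\<not> 3 dvd w"
        using uw by (auto simp: coprime6_def)
      \<comment> \<open>Here \<open>a - b = 48 n + 4 - 4 b\<close>, and \<open>4 b\<close> is 4
        modulo 32.\<close>
      have aux: "a mod 16 = b mod 16" if "a + 3 * b = 48 * n + 4" "b mod 8 = 1" for a b :: int
      proof -
        have "b = 8 * (b div 8) + 1" using that(2) by presburger
        then have "a = b + 16 * (3 * n - 2 * (b div 8))" using that(1) by simp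
        then show ?thesis by (metis mod_mult_self2)
      qed
      have "u\<^sup>2 mod 16 = w\<^sup>2 mod 16"
        using aux[OF e square_mod_8[OF odd(2)]] .
      then have "8 dvd u - w \<or> 8 dvd u + w"
        unfolding sq[OF odd(1)] sq[OF odd(2)] using odd by (auto split: if_splits; presburger)
      \<comment> \<open>The sign of \<open>w\<close> is chosen so that
        \<open>m = (u - v) / 8\<close> is an integer; then \<open>p = v + 2 m\<close> inverts the
        map.\<close>
      then obtain v where v: "\<bar>v\<bar> = w" "8 dvd u - v"
        using pos(2) by (metis abs_minus_cancel abs_of_pos diff_minus_eq_add)
      then obtain m where "u - v = 8 * m" by (auto elim: dvdE)
      moreover define p where "p = v + 2 * m"
      ultimately have pm: "u = p + 6 * m" "v = p - 2 * m" by auto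
      have "(p + 6 * m)\<^sup>2 + 3 * (p - 2 * m)\<^sup>2 = 4 * (p\<^sup>2 + 12 * m\<^sup>2)"
        by (simp add: power2_eq_square algebra_simps)
      moreover have "v\<^sup>2 = w\<^sup>2" by (metis v(1) power2_abs)
      ultimately have pm_eq: "p\<^sup>2 + 12 * m\<^sup>2 = 12 * n + 1"
        unfolding pm[symmetric] using e by simp
      have "odd a" "a mod 3 \<noteq> 0" if "a + 12 * b = 12 * n + 1" for a b :: int
        using that by presburger+
      from this[OF pm_eq] have "odd (p\<^sup>2)" "p\<^sup>2 mod 3 \<noteq> 0" .
      then have p: "odd p" "\<not> 3 dvd p" using square_mod_3[of p] by auto
      have v3: "\<not> 3 dvd p - 2 * m" using v w3 pm by (metis dvd_abs_iff)
      define s where "s = sgn p"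
      have "p \<noteq> 0" using p by auto
      then have "0 < s * p" and s: "s = 1 \<or> s = -1" by (auto simp: s_def sgn_if)
      moreover have "\<not> 3 dvd s * p - 2 * (s * m)" using v3 s by (auto; presburger)
      ultimately have "(s * p, s * m) \<in> Z"
        using p pm_eq by (auto simp: Z_def coprime6_def)
      moreover have "\<bar>s * p + 6 * (s * m)\<bar> = u" "\<bar>s * p - 2 * (s * m)\<bar> = w"
        using s pm v pos by auto
      ultimately show "(u, w) \<in> (\<lambda>(p, m). (\<bar>p + 6 * m\<bar>, \<bar>p - 2 * m\<bar>)) ` Z"
        by force
    qed
  qed
  from bij_betw_same_card[OF this] have "card ?W = card Z" ..
  \<comment> \<open>If 3 divides \<open>m\<close>, the condition on \<open>p - 2 * m\<close> follows
    from \<open>p\<close> being prime to 3 and is symmetric in \<open>m\<close>. The fixed point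
    \<open>m = 0\<close> of the sign change goes to \<open>Z2\<close>.\<close>
  define Z1 where "Z1 = {(p, m) \<in> Z. m \<noteq> 0 \<and> 3 dvd m}"
  define Z2 where "Z2 = {(p, m) \<in> Z. m = 0 \<or> \<not> 3 dvd m}"
  note \<open>card ?W = card Z\<close>
  also have "card Z = card (Z1 \<union> Z2)" by (rule arg_cong[of _ _ card]) (auto simp: Z1_def Z2_def)
  also have "\<dots> = card Z1 + card Z2"
    using \<open>finite Z\<close> by (intro card_Un_disjoint) (auto simp: Z1_def Z2_def elim: finite_subset[rotated])
  finally have "card ?W = card Z1 + card Z2" .
  moreover have "even (card Z1)"
  proof (rule even_card_negate_snd)
    show "finite Z1" using \<open>finite Z\<close> by (auto simp: Z1_def elim: finite_subset[rotated])
    fix p m assume *: "(p, m) \<in> Z1"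
    then have "\<not> 3 dvd p - 2 * (- m)" unfolding Z1_def Z_def by (clarsimp; presburger)
    with * show "m \<noteq> 0 \<and> (p, - m) \<in> Z1" by (auto simp: Z1_def Z_def)
  qed
  \<comment> \<open>If neither \<open>p\<close> nor \<open>m\<close> is divisible by 3, then exactly
    one of \<open>p - 2 m\<close> and \<open>p + 2 m\<close> is prime to 3, so exactly one sign of
    \<open>m\<close> occurs in \<open>Z2\<close>.\<close>
  moreover have "bij_betw (\<lambda>(p, m). (p, \<bar>m\<bar>)) Z2 ?V"
    unfolding bij_betw_def
  proof
    show "inj_on (\<lambda>(p, m). (p, \<bar>m\<bar>)) Z2"
    proof (rule inj_onI, clarsimp)
      fix p m m' assume "(p, m) \<in> Z2" "(p, m') \<in> Z2" and *: "\<bar>m\<bar> = \<bar>m'\<bar>"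
      then have "\<not> 3 dvd p" "\<not> 3 dvd p - 2 * m" "\<not> 3 dvd p - 2 * m'" "m = 0 \<or> \<not> 3 dvd m"
        by (auto simp: Z2_def Z_def coprime6_def)
      with * show "m = m'" by presburger
    qed
    show "(\<lambda>(p, m). (p, \<bar>m\<bar>)) ` Z2 = ?V"
    proof (intro equalityI subsetI; clarify)
      fix p m assume "(p, m) \<in> Z2"
      then show "p \<in> coprime6 \<and> 0 \<le> \<bar>m\<bar> \<and> (\<bar>m\<bar> = 0 \<or> \<not> 3 dvd \<bar>m\<bar>) \<and> p\<^sup>2 + 12 * \<bar>m\<bar>\<^sup>2 = 12 * n + 1"
        by (auto simp: Z2_def Z_def)
    next
      fix p m
      assume *: "p \<in> coprime6" "0 \<le> m" "m = 0 \<or> \<not> 3 dvd m" "p\<^sup>2 + 12 * m\<^sup>2 = 12 * n + 1"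
      have "\<not> 3 dvd p" using * by (simp add: coprime6_def)
      then have "\<not> 3 dvd p - 2 * m \<or> \<not> 3 dvd p - 2 * (- m)" using *(3) by presburger
      then obtain m' where "\<bar>m'\<bar> = m" "\<not> 3 dvd p - 2 * m'" using *(2) by (metis abs_minus abs_of_nonneg)
      then have "(p, m') \<in> Z2" using * by (auto simp: Z2_def Z_def)
      with \<open>\<bar>m'\<bar> = m\<close> show "(p, m) \<in> (\<lambda>(p, m). (p, \<bar>m\<bar>)) ` Z2" by force
    qed
  qed
  then have "card Z2 = card ?V" by (rule bij_betw_same_card)
  ultimately show ?thesis by simp
qed

section \<open>The pentagonal number theorem over the field with two elements\<close>

text \<open>
  Shanks' finite form of Euler's theorem: modulo \<open>q ^ (n + 1)\<close> only the product with \<open>s = 0\<close>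
  survives on the left-hand side.
\<close>

lemma finite_pentagonal_sum:
  fixes q :: "'a :: comm_ring_1"
  shows "(\<Sum>s\<le>n. (-1) ^ s * (\<Prod>j\<in>{s<..n}. 1 - q ^ j) * q ^ (s * n + \<Sum>{..s})) =
    (\<Sum>k\<le>n. (-1) ^ k * q ^ (k\<^sup>2 + \<Sum>{..k})) + (\<Sum>k=1..n. (-1) ^ k * q ^ (k\<^sup>2 + \<Sum>{..<k}))"
proof (induction n)
  case (Suc n)
  define Q where "Q s = (\<Prod>j\<in>{s<..n}. 1 - q ^ j)" for s
  have Q_Suc: "Q s = (1 - q ^ Suc s) * Q (Suc s)" if "s < n" for s
  proof -
    have "{s<..n} = insert (Suc s) {Suc s<..n}" using that by auto
    then show ?thesis by (simp add: Q_def)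
  qed
  \<comment> \<open>These summands are the difference between the sums for \<open>n + 1\<close> and
    \<open>n\<close>. At \<open>m = n\<close> they leave the new term \<open>k = n + 1\<close> of
    the second sum on the right; the summand \<open>s = n + 1\<close> gives that of the
    first.\<close>
  have telescope: "(\<Sum>s\<le>m. (-1) ^ s * Q s * q ^ (s * n + \<Sum>{..s}) * (q ^ s * (1 - q ^ Suc n) - 1)) =
    - ((-1) ^ m * Q m * q ^ (Suc m * Suc n + \<Sum>{..m}))" if "m \<le> n" for m
    using that
  proof (induction m)
    case (Suc m)
    have "Suc m * Suc n + \<Sum>{..m} = Suc m * n + \<Sum>{..Suc m}" by simp
    moreover have "Suc (Suc m) * Suc n + \<Sum>{..Suc m} = (Suc m * n + \<Sum>{..Suc m}) + Suc m + Suc n" by simp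
    ultimately show ?case
      using Suc Q_Suc[of m] by (simp only: sum.atMost_Suc power_add) (simp add: algebra_simps)
  qed (simp add: algebra_simps)
  have "(\<Sum>s\<le>n. (-1) ^ s * (\<Prod>j\<in>{s<..Suc n}. 1 - q ^ j) * q ^ (s * Suc n + \<Sum>{..s})) =
    (\<Sum>s\<le>n. (-1) ^ s * Q s * q ^ (s * n + \<Sum>{..s}) * (q ^ s * (1 - q ^ Suc n) - 1) +
      (-1) ^ s * Q s * q ^ (s * n + \<Sum>{..s}))"
  proof (rule sum.cong)
    fix s assume "s \<in> {..n}"
    then have "{s<..Suc n} = insert (Suc n) {s<..n}" by auto
    then have eq: "(\<Prod>j\<in>{s<..Suc n}. 1 - q ^ j) = (1 - q ^ Suc n) * Q s" by (simp add: Q_def)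
    show "(-1) ^ s * (\<Prod>j\<in>{s<..Suc n}. 1 - q ^ j) * q ^ (s * Suc n + \<Sum>{..s}) =
      (-1) ^ s * Q s * q ^ (s * n + \<Sum>{..s}) * (q ^ s * (1 - q ^ Suc n) - 1) +
      (-1) ^ s * Q s * q ^ (s * n + \<Sum>{..s})"
      unfolding eq by (simp add: power_add algebra_simps)
  qed simp
  also have "\<dots> = - ((-1) ^ n * q ^ (Suc n * Suc n + \<Sum>{..n})) +
    (\<Sum>s\<le>n. (-1) ^ s * Q s * q ^ (s * n + \<Sum>{..s}))"
    unfolding sum.distrib by (subst telescope[OF order_refl]) (simp add: Q_def)
  finally show ?case
    using Suc.IH by (simp add: Q_def lessThan_Suc_atMost power2_eq_square add_ac)
qed simp

section \<open>Generating functions modulo 2\<close>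

definition series :: "'a set \<Rightarrow> ('a \<Rightarrow> nat) \<Rightarrow> bit fps" where
  "series S f = Abs_fps (\<lambda>n. of_nat (card {s \<in> S. f s = n}))"

lemma series_nth: "series S f $ n = of_nat (card {s \<in> S. f s = n})"
  by (simp add: series_def)

text \<open>The fibre of the added weights over \<open>n\<close> is the disjoint union of products
  of fibres over \<open>i\<close> and \<open>n - i\<close>. Finiteness matters because
  \<open>card\<close> is 0 on infinite sets.\<close>

lemma series_mult:
  assumes "\<And>n. finite {s \<in> S. f s = n}" "\<And>n. finite {t \<in> T. g t = n}"
  shows "series S f * series T g = series (S \<times> T) (\<lambda>(s, t). f s + g t)"
proof (rule fps_ext)
  fix n
  let ?S = "\<lambda>i. {s \<in> S. f s = i}" and ?T = "\<lambda>i. {t \<in> T. g t = i}"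
  have "(series S f * series T g) $ n = of_nat (\<Sum>i=0..n. card (?S i \<times> ?T (n - i)))"
    by (simp add: fps_mult_nth series_nth card_cartesian_product)
  also have "(\<Sum>i=0..n. card (?S i \<times> ?T (n - i))) = card (\<Union>i\<in>{0..n}. ?S i \<times> ?T (n - i))"
    using assms by (subst card_UN_disjoint) auto
  also have "(\<Union>i\<in>{0..n}. ?S i \<times> ?T (n - i)) = {z \<in> S \<times> T. (case z of (s, t) \<Rightarrow> f s + g t) = n}"
    by auto
  finally show "(series S f * series T g) $ n = series (S \<times> T) (\<lambda>(s, t). f s + g t) $ n"
    by (simp add: series_nth)
qed

lemma series_compose_X_power:
  assumes "0 < k"
  shows "series S f oo fps_X ^ k = series S (\<lambda>s. k * f s)"
proof (rule fps_ext)
  fix n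
  have "{s \<in> S. k * f s = n} = (if k dvd n then {s \<in> S. f s = n div k} else {})"
    using assms by auto
  then show "(series S f oo fps_X ^ k) $ n = series S (\<lambda>s. k * f s) $ n"
    by (simp add: fps_nth_compose_X_power series_nth)
qed

lemma of_nat_bit: "(of_nat n :: bit) = of_bool (odd n)"
  by (induction n) auto

lemma bit_add_self [simp]: "(x :: bit) + x = 0"
  by (cases x) auto

text \<open>This is the Frobenius map: the terms for \<open>i\<close> and \<open>n - i\<close>
  cancel, and the middle one is the square of a bit, hence that bit.\<close>

lemma bit_fps_square: "(f :: bit fps) * f = f oo fps_X ^ 2"
proof (rule fps_ext)
  fix n
  let ?h = "\<lambda>i. f $ i * f $ (n - i)"
  let ?L = "{i. 2 * i < n}" and ?M = "{i. 2 * i = n}" and ?R = "{i. i \<le> n \<and> n < 2 * i}"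
  have fin: "finite ?L" "finite ?M" "finite ?R"
    by (rule finite_subset[of _ "{..n}"]; auto)+
  have "{0..n} = (?L \<union> ?R) \<union> ?M" by auto
  then have "(f * f) $ n = sum ?h ((?L \<union> ?R) \<union> ?M)" by (simp only: fps_mult_nth)
  also have "\<dots> = (sum ?h ?L + sum ?h ?R) + sum ?h ?M"
    using fin by (subst sum.union_disjoint; (subst sum.union_disjoint)?) auto
  also have "sum ?h ?R = sum ?h ?L"
    by (rule sum.reindex_bij_witness[where i = "\<lambda>i. n - i" and j = "\<lambda>i. n - i"]) (auto simp: mult.commute)
  also have "sum h ?M = (if even n then h (n div 2) else 0)" for h :: "nat \<Rightarrow> bit"
  proof -
    have "?M = (if even n then {n div 2} else {})" by auto
    then show ?thesis by simp
  qed
  finally have "(f * f) $ n = (if even n then f $ (n div 2) * f $ (n - n div 2) else 0)"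
    by (simp del: mult_bit_eq_and)
  moreover have "n - n div 2 = n div 2" if "even n"
    using that by auto
  ultimately show "(f * f) $ n = (f oo fps_X ^ 2) $ n"
    by (cases "f $ (n div 2)") (simp_all add: fps_nth_compose_X_power)
qed

text \<open>A series in \<open>X\<^sup>2\<close> has only even exponents, so it can be pulled out
  when even coefficients are extracted.\<close>

lemma fps_mult_compose_X2_nth_even:
  fixes f g :: "'a :: comm_ring_1 fps"
  shows "(f * (g oo fps_X ^ 2)) $ (2 * n) = (Abs_fps (\<lambda>i. f $ (2 * i)) * g) $ n"
proof -
  have "(f * (g oo fps_X ^ 2)) $ (2 * n) =
      (\<Sum>i=0..2 * n. if even i then f $ i * g $ (n - i div 2) else 0)"
    unfolding fps_mult_nth fps_nth_compose_X_power
    by (intro sum.cong) (auto elim!: evenE simp flip: diff_mult_distrib2)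
  also have "\<dots> = (\<Sum>i\<in>(*) 2 ` {0..n}. f $ i * g $ (n - i div 2))"
    by (rule sum.mono_neutral_cong_right) (auto elim!: evenE)
  also have "\<dots> = (\<Sum>i=0..n. f $ (2 * i) * g $ (n - i))"
    by (subst sum.reindex) (auto simp: inj_on_def)
  finally show ?thesis by (simp add: fps_mult_nth)
qed

section \<open>Generalized pentagonal numbers and theta\<close>

definition pent :: "int \<Rightarrow> nat" where
  "pent u = nat ((u\<^sup>2 - 1) div 24)"

lemma pent: "u \<in> coprime6 \<Longrightarrow> u\<^sup>2 = 24 * int (pent u) + 1"
proof -
  assume "u \<in> coprime6"
  then have "u\<^sup>2 mod 24 = 1" by (auto simp: coprime6_def intro: square_coprime6)
  moreover define c where "c = u\<^sup>2 div 24"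
  ultimately have "u\<^sup>2 = 24 * c + 1" by (metis mult_div_mod_eq)
  moreover have "0 \<le> c" by (simp add: c_def pos_imp_zdiv_nonneg_iff)
  ultimately show ?thesis by (simp add: pent_def)
qed

lemma pent_eqI: "u\<^sup>2 = 24 * int n + 1 \<Longrightarrow> pent u = n"
  by (simp add: pent_def)

lemma finite_mult_pent:
  assumes "0 < k"
  shows "finite {u \<in> coprime6. k * pent u = n}"
proof (rule finite_subset)
  show "{u \<in> coprime6. k * pent u = n} \<subseteq> {0..24 * int n + 1}"
  proof clarify
    fix u assume "u \<in> coprime6"
    then have "u\<^sup>2 = 24 * int (pent u) + 1" "0 < u" by (auto simp: pent coprime6_def)
    moreover have "int (pent u) \<le> int (k * pent u)" using assms by (simp only: of_nat_le_iff) simp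
    moreover have "u \<le> u\<^sup>2" using self_le_power[of u 2] \<open>0 < u\<close> by simp
    ultimately have "0 \<le> u \<and> u \<le> 24 * int (k * pent u) + 1" by linarith
    then show "u \<in> {0..24 * int (k * pent u) + 1}" by (simp only: atLeastAtMost_iff)
  qed
qed simp

lemmas finite_pent = finite_mult_pent[of 1, simplified]

text \<open>Multiplication by 24 completes the square and turns the exponent condition into a
  quadratic form equation.\<close>

lemma mult_pent_add_square_eq_iff:
  assumes "u \<in> coprime6"
  shows "k * pent u + nat (m\<^sup>2) = n \<longleftrightarrow> int k * u\<^sup>2 + 24 * m\<^sup>2 = 24 * int n + int k"
proof -
  have "k * pent u + nat (m\<^sup>2) = n \<longleftrightarrow> int (k * pent u + nat (m\<^sup>2)) = int n"
    by (simp only: of_nat_eq_iff)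
  also have "\<dots> \<longleftrightarrow> 24 * (int k * int (pent u)) + 24 * m\<^sup>2 = 24 * int n"
    by auto
  finally show ?thesis
    by (simp add: pent[OF assms] algebra_simps)
qed

abbreviation theta :: "bit fps" where
  "theta \<equiv> series coprime6 pent"

lemma four_sum_atMost: "2 * int (\<Sum>{..k}) = int k * (int k + 1)"
  by (induction k) (auto simp: algebra_simps)

text \<open>Factors with \<open>j > n\<close> leave the coefficients up to \<open>n\<close>
  unchanged, so this truncation expresses the infinite product. It is read off from Shanks' identity
  at \<open>q = X\<close>.\<close>

lemma theta_nth:
  assumes "i \<le> n"
  shows "theta $ i = (\<Prod>j\<in>{0<..n}. 1 - fps_X ^ j :: bit fps) $ i"
proof -
  define a where "a k = k\<^sup>2 + \<Sum>{..k}" for k :: nat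
  define b where "b k = k\<^sup>2 + \<Sum>{..<k}" for k :: nat
  have pent_a: "pent (6 * int k + 1) = a k" for k
    using four_sum_atMost[of k] by (intro pent_eqI) (simp add: a_def power2_eq_square algebra_simps)
  have pent_b: "pent (6 * int k - 1) = b k" for k
  proof (intro pent_eqI)
    have "2 * int (\<Sum>{..<k}) = int k * (int k - 1)"
      using four_sum_atMost[of "k - 1"] by (cases k) (simp_all add: lessThan_Suc_atMost algebra_simps)
    then show "(6 * int k - 1)\<^sup>2 = 24 * int (b k) + 1"
      by (simp add: b_def power2_eq_square algebra_simps)
  qed
  \<comment> \<open>Restricting \<open>k\<close> to at most \<open>n\<close> therefore loses no
    solution when \<open>i \<le> n\<close>.\<close>
  have le: "k \<le> a k" "k \<le> b k" for k
    by (auto simp: a_def b_def power2_eq_square intro: trans_le_add1)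
  let ?A = "{k \<in> {..n}. a k = i}" and ?B = "{k \<in> {1..n}. b k = i}"
  have "{u \<in> coprime6. pent u = i} = (\<lambda>k. 6 * int k + 1) ` ?A \<union> (\<lambda>k. 6 * int k - 1) ` ?B"
  proof (intro equalityI subsetI)
    fix u assume u: "u \<in> {u \<in> coprime6. pent u = i}"
    then have "0 < u" "u mod 6 = 1 \<or> u mod 6 = 5" by (auto simp: coprime6_def) presburger+
    moreover obtain k where "u div 6 = int k"
      using \<open>0 < u\<close> by (metis nonneg_int_cases less_imp_le pos_imp_zdiv_nonneg_iff zero_less_numeral)
    ultimately have "u = 6 * int k + 1 \<or> u = 6 * int (k + 1) - 1 \<and> 1 \<le> k + 1"
      using mult_div_mod_eq[of 6 u] by (elim disjE) simp_all
    then obtain k where "u = 6 * int k + 1 \<or> u = 6 * int k - 1 \<and> 1 \<le> k" by blast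
    then show "u \<in> (\<lambda>k. 6 * int k + 1) ` ?A \<union> (\<lambda>k. 6 * int k - 1) ` ?B"
      using u assms pent_a pent_b le[of k] by auto
  next
    fix u assume "u \<in> (\<lambda>k. 6 * int k + 1) ` ?A \<union> (\<lambda>k. 6 * int k - 1) ` ?B"
    then show "u \<in> {u \<in> coprime6. pent u = i}"
      using pent_a pent_b by (auto simp: coprime6_def; presburger)
  qed
  then have "card {u \<in> coprime6. pent u = i} =
      card ((\<lambda>k. 6 * int k + 1) ` ?A \<union> (\<lambda>k. 6 * int k - 1) ` ?B)" by simp
  also have "\<dots> = card ((\<lambda>k. 6 * int k + 1) ` ?A) + card ((\<lambda>k. 6 * int k - 1) ` ?B)"
    by (rule card_Un_disjoint) (auto; presburger)+
  also have "\<dots> = card ?A + card ?B"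
    by (simp add: card_image inj_on_def)
  finally have "theta $ i = (\<Sum>k\<le>n. of_bool (a k = i)) + (\<Sum>k=1..n. of_bool (b k = i))"
    by (simp add: series_nth sum_of_bool_eq Int_def conj_commute)
  also have "\<dots> = ((\<Sum>k\<le>n. (-1) ^ k * fps_X ^ a k) + (\<Sum>k=1..n. (-1) ^ k * fps_X ^ b k)) $ i"
  proof -
    \<comment> \<open>In characteristic 2 the signs of the pentagonal number theorem
      disappear.\<close>
    have "(-1 :: bit fps) = 1" by (rule fps_ext) simp
    then have "((-1) ^ k * fps_X ^ c) $ i = (of_bool (c = i) :: bit)" for k c
      by (simp only: power_one mult_1_left fps_X_power_nth) auto
    then show ?thesis by (simp only: fps_add_nth fps_sum_nth)
  qed
  also have "\<dots> = (\<Sum>s\<le>n. (-1) ^ s * (\<Prod>j\<in>{s<..n}. 1 - fps_X ^ j) * fps_X ^ (s * n + \<Sum>{..s})) $ i"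
    by (subst finite_pentagonal_sum) (simp add: a_def b_def)
  also have "\<dots> = (\<Sum>s\<in>{0}. (-1) ^ s * (\<Prod>j\<in>{s<..n}. 1 - fps_X ^ j) * fps_X ^ (s * n + \<Sum>{..s})) $ i"
    unfolding fps_sum_nth
  proof (rule sum.mono_neutral_right)
    show "\<forall>s\<in>{..n} - {0}. ((-1) ^ s * (\<Prod>j\<in>{s<..n}. 1 - fps_X ^ j) * fps_X ^ (s * n + \<Sum>{..s})) $ i = (0 :: bit)"
    proof
      \<comment> \<open>For \<open>s \<ge> 1\<close> the exponent exceeds \<open>n\<close>, so only
        the full product remains.\<close>
      fix s assume s: "s \<in> {..n} - {0}"
      then have "n \<le> s * n" "s \<le> \<Sum>{..s}" "0 < s" by (auto intro: member_le_sum)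
      with assms have "i < s * n + \<Sum>{..s}" by linarith
      then show "((-1) ^ s * (\<Prod>j\<in>{s<..n}. 1 - fps_X ^ j) * fps_X ^ (s * n + \<Sum>{..s})) $ i = (0 :: bit)"
        by (simp add: fps_X_power_mult_right_nth)
    qed
  qed auto
  finally show ?thesis by simp
qed


section \<open>The parity of \<open>b\<^sub>3(2 n)\<close>\<close>

definition partition_series :: "nat set \<Rightarrow> 'a :: comm_ring_1 fps" where
  "partition_series A = Abs_fps (\<lambda>n. of_nat (card {P. set_mset P \<subseteq> A \<and> sum_mset P = n}))"

lemma finite_partitions_in:
  fixes n :: nat
  assumes "0 \<notin> A"
  shows "finite {P. set_mset P \<subseteq> A \<and> sum_mset P = n}"
proof (rule finite_subset[OF _ finite_partitions[of n]])
  have "0 < p" if "p \<in> A" for p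
    using assms that by (cases p) auto
  then show "{P. set_mset P \<subseteq> A \<and> sum_mset P = n} \<subseteq> partitions n"
    by (auto simp: partitions_def)
qed

text \<open>A partition with parts in \<open>insert a A\<close> either avoids \<open>a\<close> or
  yields a partition of \<open>n - a\<close> after removal of one copy of \<open>a\<close>. Hence
  the factor \<open>1 - X ^ a\<close> removes \<open>a\<close> from the allowed parts.\<close>

lemma prod_partition_series:
  assumes "finite A" "0 \<notin> A"
  shows "(\<Prod>a\<in>A. 1 - fps_X ^ a) * partition_series A = (1 :: 'a :: comm_ring_1 fps)"
  using assms
proof (induction A)
  case empty
  have "{P. set_mset P \<subseteq> {} \<and> sum_mset P = n} = (if n = 0 then {{#}} else {})" for n :: nat
    by auto
  then show ?case by (auto simp: partition_series_def fps_eq_iff)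
next
  case (insert a A)
  let ?P = "\<lambda>A n. {P :: nat multiset. set_mset P \<subseteq> A \<and> sum_mset P = n}"
  have "(1 - fps_X ^ a) * partition_series (insert a A) = (partition_series A :: 'a fps)"
  proof (rule fps_ext)
    fix n
    have split: "?P (insert a A) n = ?P A n \<union> {P \<in> ?P (insert a A) n. a \<in># P}"
      by auto
    have "card (?P (insert a A) n) = card (?P A n) + card {P \<in> ?P (insert a A) n. a \<in># P}"
      using insert by (subst split, intro card_Un_disjoint) (auto intro: finite_partitions_in finite_subset[OF _ finite_partitions_in])
    moreover have "{P \<in> ?P (insert a A) n. a \<in># P} = (if a \<le> n then add_mset a ` ?P (insert a A) (n - a) else {})"
    proof -
      have "P \<in> add_mset a ` ?P (insert a A) (n - a)" if "P \<in> ?P (insert a A) n" "a \<in># P" for P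
        using that by (intro image_eqI[of _ _ "P - {#a#}"]) (auto dest: in_diffD simp: sum_mset_diff)
      moreover have "a \<le> n" if "P \<in> ?P (insert a A) n" "a \<in># P" for P
        using that by (auto dest!: multi_member_split)
      ultimately show ?thesis by auto
    qed
    ultimately have "card (?P (insert a A) n) = card (?P A n) + (if a \<le> n then card (?P (insert a A) (n - a)) else 0)"
      by (simp add: card_image inj_on_def)
    then show "((1 - fps_X ^ a) * partition_series (insert a A)) $ n = (partition_series A :: 'a fps) $ n"
      by (simp add: partition_series_def left_diff_distrib fps_X_power_mult_nth)
  qed
  then show ?case
    using insert by (simp add: mult.commute[of "1 - fps_X ^ a"] mult.assoc)
qed

definition b3 :: "bit fps" where
  "b3 = Abs_fps (\<lambda>n. of_nat (num_regular_partitions 3 n))"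

lemma b3_theta: "b3 * theta = theta oo fps_X ^ 3"
proof (rule fps_ext)
  fix n :: nat
  \<comment> \<open>The bound \<open>3 * n\<close> makes the multiples of 3 in the range exactly
    three times the numbers up to \<open>n\<close>, so what survives the cancellation is a
    truncation of \<open>theta\<close> at \<open>X ^ 3\<close>.\<close>
  define A where "A = {j \<in> {0<..3 * n}. \<not> 3 dvd j}"
  let ?p = "\<lambda>j. 1 - fps_X ^ j :: bit fps"
  have "b3 $ i = partition_series A $ i" if "i \<le> n" for i
  proof -
    have "p \<le> i" if "sum_mset P = i" "p \<in># P" for p and P :: "nat multiset"
      using that by (auto dest!: multi_member_split)
    then have "regular_partitions 3 i = {P. set_mset P \<subseteq> A \<and> sum_mset P = i}"
      using that by (fastforce simp: regular_partitions_def partitions_def A_def subset_iff)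
    then show ?thesis
      by (simp add: b3_def partition_series_def num_regular_partitions_def)
  qed
  moreover have "theta $ i = (\<Prod>j\<in>{0<..3 * n}. ?p j) $ i" if "i \<le> n" for i
    using that by (intro theta_nth) simp
  ultimately have "(b3 * theta) $ n = (partition_series A * (\<Prod>j\<in>{0<..3 * n}. ?p j)) $ n"
    by (simp add: fps_mult_nth)
  also have "(\<Prod>j\<in>{0<..3 * n}. ?p j) = (\<Prod>j\<in>A. ?p j) * (\<Prod>j\<in>(*) 3 ` {0<..n}. ?p j)"
  proof -
    have "{0<..3 * n} = A \<union> (*) 3 ` {0<..n}" by (auto simp: A_def elim!: dvdE)
    moreover have "A \<inter> (*) 3 ` {0<..n} = {}" by (auto simp: A_def)
    moreover have "finite A" by (simp add: A_def)
    ultimately show ?thesis by (simp only: prod.union_disjoint finite_imageI finite_greaterThanAtMost)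
  qed
  also have "partition_series A * ((\<Prod>j\<in>A. ?p j) * (\<Prod>j\<in>(*) 3 ` {0<..n}. ?p j)) =
      (\<Prod>j\<in>A. ?p j) * partition_series A * (\<Prod>j\<in>(*) 3 ` {0<..n}. ?p j)"
    by (simp only: mult_ac)
  also have "\<dots> = (\<Prod>j\<in>(*) 3 ` {0<..n}. ?p j)"
    by (subst prod_partition_series) (simp_all add: A_def)
  also have "\<dots> = (\<Prod>j\<in>{0<..n}. ?p j) oo fps_X ^ 3"
    by (subst prod.reindex)
      (auto simp: inj_on_def fps_compose_prod_distrib fps_compose_sub_distrib fps_X_power_compose power_mult)
  finally show "(b3 * theta) $ n = (theta oo fps_X ^ 3) $ n"
    by (simp add: fps_nth_compose_X_power theta_nth[of "n div 3" n])
qed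


section \<open>The even part of the series of b3\<close>

definition squares_not_3 :: "bit fps" where
  "squares_not_3 = series {m. 0 \<le> m \<and> (m = 0 \<or> \<not> 3 dvd m)} (\<lambda>m. nat (m\<^sup>2))"

lemma finite_squares_not_3: "finite {m \<in> {m. 0 \<le> m \<and> (m = 0 \<or> \<not> 3 dvd m)}. nat (m\<^sup>2) = n}"
proof (rule finite_subset)
  show "{m \<in> {m. 0 \<le> m \<and> (m = 0 \<or> \<not> 3 dvd m)}. nat (m\<^sup>2) = n} \<subseteq> {0..int n}"
  proof clarsimp
    fix m :: int assume "0 \<le> m"
    then show "m \<le> m\<^sup>2" using self_le_power[of m 2] by (cases "m = 0") auto
  qed
qed simp

lemma even_part_b3: "Abs_fps (\<lambda>n. of_nat (num_regular_partitions 3 (2 * n))) = theta * squares_not_3"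
proof -
  let ?G = "Abs_fps (\<lambda>n. b3 $ (2 * n))"
  have mult: "theta * (theta oo fps_X ^ 3) =
      series (coprime6 \<times> coprime6) (\<lambda>(u, w). pent u + 3 * pent w)"
    unfolding series_compose_X_power[of 3, simplified]
    by (rule series_mult) (simp_all only: finite_pent finite_mult_pent zero_less_numeral)
  have mult': "(theta oo fps_X ^ 2) * squares_not_3 =
      series (coprime6 \<times> {m. 0 \<le> m \<and> (m = 0 \<or> \<not> 3 dvd m)}) (\<lambda>(p, m). 2 * pent p + nat (m\<^sup>2))"
    unfolding series_compose_X_power[of 2, simplified] squares_not_3_def
    by (rule series_mult[OF finite_mult_pent finite_squares_not_3]) simp
  have "?G * theta = (theta oo fps_X ^ 2) * squares_not_3"
  proof (rule fps_ext)
    fix n :: nat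
    have "(?G * theta) $ n = (b3 * (theta oo fps_X ^ 2)) $ (2 * n)"
      by (simp add: fps_mult_compose_X2_nth_even)
    \<comment> \<open>By Frobenius the left side is \<open>b3 * theta * theta\<close>, and
      \<open>b3 * theta\<close> is \<open>theta\<close> at \<open>X ^ 3\<close>.\<close>
    also have "b3 * (theta oo fps_X ^ 2) = theta * (theta oo fps_X ^ 3)"
      unfolding bit_fps_square[symmetric] b3_theta[symmetric] by (simp only: mult_ac)
    also have "\<dots> $ (2 * n) = of_nat (card {(u, w). u \<in> coprime6 \<and> w \<in> coprime6 \<and> u\<^sup>2 + 3 * w\<^sup>2 = 48 * int n + 4})"
      unfolding mult series_nth
      by (intro arg_cong[of _ _ "\<lambda>A. of_nat (card A)"]) (auto simp: pent)
    \<comment> \<open>This form equation is \<open>2 * pent p + m\<^sup>2 = n\<close> multiplied by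
      24, completed to squares and halved.\<close>
    also have "\<dots> = of_nat (card {(p, m). p \<in> coprime6 \<and> 0 \<le> m \<and> (m = 0 \<or> \<not> 3 dvd m) \<and> p\<^sup>2 + 12 * m\<^sup>2 = 12 * int n + 1})"
      unfolding of_nat_bit using parity_card_reps[of "int n"] by simp
    also have "\<dots> = ((theta oo fps_X ^ 2) * squares_not_3) $ n"
      unfolding mult' series_nth
      by (intro arg_cong[of _ _ "\<lambda>A. of_nat (card A)"]) (auto simp: pent mult_pent_add_square_eq_iff[of _ 2])
    finally show "(?G * theta) $ n = ((theta oo fps_X ^ 2) * squares_not_3) $ n" .
  qed
  \<comment> \<open>Frobenius turns \<open>theta\<close> at \<open>X\<^sup>2\<close> into
    \<open>theta * theta\<close>; one factor cancels, as power series over a field form an integral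
    domain.\<close>
  then have "theta * ?G = theta * (theta * squares_not_3)"
    unfolding bit_fps_square[symmetric] by (simp only: mult_ac)
  moreover have "theta $ 0 \<noteq> 0" using theta_nth[of 0 0] by simp
  then have "theta \<noteq> 0" by auto
  ultimately show ?thesis by (simp add: b3_def)
qed

theorem theorem1p3:
  fixes n \<alpha> :: nat
  assumes "\<alpha> \<in> {6, 64, 93, 122, 151, 180, 209, 238, 267, 296, 325, 354, 383, 412, 441, 470, 499, 528,
    557, 586, 615, 644, 673, 702, 731, 760, 789, 818}"
  shows "[num_regular_partitions 3 (2 * (29\<^sup>2 * n + \<alpha>)) = 0] (mod 2)"
proof -
  define N where "N = 29\<^sup>2 * n + \<alpha>"
  \<comment> \<open>The listed values are the residues modulo \<open>29\<^sup>2\<close> that are 6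
    modulo 29, except 35, for which \<open>24 * 35 + 1 = 29\<^sup>2\<close>.\<close>
  have "\<exists>k. 24 * int \<alpha> + 1 = 29 * k \<and> \<not> 29 dvd k"
    using assms by (elim insertE emptyE; simp)
  then obtain k where k: "24 * int \<alpha> + 1 = 29 * k" "\<not> 29 dvd k" by blast
  \<comment> \<open>Adding multiples of \<open>29\<^sup>2\<close> to \<alpha> changes the cofactor
    of 29 only by multiples of 29.\<close>
  define M where "M = 29 * (24 * int n) + k"
  have M: "29 * M = 24 * int N + 1" using k(1) by (simp add: M_def N_def)
  have "\<not> 29 dvd M" using k(2) by (simp add: M_def dvd_add_right_iff)
  have "of_nat (num_regular_partitions 3 (2 * N)) = (theta * squares_not_3) $ N"
    by (simp flip: even_part_b3)
  also have "\<dots> = of_nat (card {(u, m). u \<in> coprime6 \<and> 0 \<le> m \<and> (m = 0 \<or> \<not> 3 dvd m) \<and> u\<^sup>2 + 24 * m\<^sup>2 = 24 * int N + 1})"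
    unfolding squares_not_3_def series_mult[OF finite_pent finite_squares_not_3] series_nth
    by (intro arg_cong[of _ _ "\<lambda>A. of_nat (card A)"]) (auto simp: pent mult_pent_add_square_eq_iff[of _ 1, simplified])
  also have "\<dots> = 0"
    unfolding of_nat_bit using even_card_reps_29[OF M \<open>\<not> 29 dvd M\<close>] by simp
  finally show ?thesis
    by (simp add: of_nat_bit cong_0_iff N_def)
qed

end
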